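(* Let $X$ be a nonzero separable Banach space. Then $X$ can be equivalently renormed to be almost square (ASQ) if and only if $X$ contains a copy of $c_0$.
   Context: All Banach spaces are real. $S_X$ and $B_X$ denote the unit sphere and closed unit ball of $X$. A Banach space $X$ is almost square (ASQ) if for every finite subset $(x_i)_{i=1}^N \subset S_X$ there exists a sequence $(y_n)\subset B_X$ such that $\|x_i\pm y_n\|\to 1$ for every $i=1,\ldots,N$ and $\|y_n\|\to 1$. "Equivalently renormed to be ASQ" means that there is an equivalent norm on $X$ under which $X$ is ASQ. "Contains a copy of $c_0$" means that $X$ has a subspace linearly isomorphic to $c_0$. *)

theory Defs
  imports "HOL-Analysis.Analysis"
begin

text \<open>
  A renorming of a space changes the norm but not the underlying vector space, so norms other than
  the type class norm are represented as functions \<open>N :: 'a \<Rightarrow> real\<close> on the carrier type.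
\<close>

definition is_norm :: "('a::real_vector \<Rightarrow> real) \<Rightarrow> bool" where
  "is_norm N \<longleftrightarrow>
     (\<forall>x. N x = 0 \<longleftrightarrow> x = 0) \<and>
     (\<forall>a x. N (a *\<^sub>R x) = \<bar>a\<bar> * N x) \<and>
     (\<forall>x y. N (x + y) \<le> N x + N y)"

definition equivalent_norm :: "('a::real_normed_vector \<Rightarrow> real) \<Rightarrow> bool" where
  "equivalent_norm N \<longleftrightarrow>
     is_norm N \<and> (\<exists>a>0. \<exists>b>0. \<forall>x. a * norm x \<le> N x \<and> N x \<le> b * norm x)"

definition almost_square :: "('a::real_vector \<Rightarrow> real) \<Rightarrow> bool" where
  "almost_square N \<longleftrightarrow>
     (\<forall>F. finite F \<and> F \<subseteq> {x. N x = 1} \<longrightarrow>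
        (\<exists>y :: nat \<Rightarrow> 'a.
           range y \<subseteq> {x. N x \<le> 1} \<and>
           (\<forall>x\<in>F. (\<lambda>n. N (x + y n)) \<longlonglongrightarrow> 1 \<and> (\<lambda>n. N (x - y n)) \<longlonglongrightarrow> 1) \<and>
           (\<lambda>n. N (y n)) \<longlonglongrightarrow> 1))"

text \<open>
  Since the topology of \<open>nat\<close> is discrete, \<open>nat \<Rightarrow>\<^sub>C real\<close> is the space of all bounded real sequences
  with the supremum norm; the null sequences form its subspace \<open>c0\<close>.
\<close>

definition c0 :: "(nat \<Rightarrow>\<^sub>C real) set" where
  "c0 = {f. apply_bcontfun f \<longlonglongrightarrow> 0}"

definition linear_isomorphic ::
    "'a::real_normed_vector set \<Rightarrow> 'b::real_normed_vector set \<Rightarrow> bool" where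
  "linear_isomorphic V W \<longleftrightarrow>
     (\<exists>f g. homeomorphism V W f g \<and>
        (\<forall>x\<in>V. \<forall>y\<in>V. f (x + y) = f x + f y) \<and>
        (\<forall>a. \<forall>x\<in>V. f (a *\<^sub>R x) = a *\<^sub>R f x))"

definition contains_copy_of_c0 :: "'a::real_normed_vector itself \<Rightarrow> bool" where
  "contains_copy_of_c0 _ \<longleftrightarrow> (\<exists>Y :: 'a set. subspace Y \<and> linear_isomorphic c0 Y)"

lemma is_norm_norm: "is_norm (norm :: 'a::real_normed_vector \<Rightarrow> real)"
  by (simp add: is_norm_def norm_triangle_ineq)

lemma subspace_c0: "subspace c0"
  unfolding subspace_def c0_def
  by (auto intro!: tendsto_eq_intros)

end

theory Submission
  imports Defs
begin

text \<open>
  If \<open>N\<close> is almost square, one can choose inductively vectors \<open>y\<^sub>i\<close> of norm close to \<open>1\<close> such that all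
  sums \<open>\<Sum>i<n. \<plusminus> y\<^sub>i\<close> have norm below \<open>3 / 2\<close>: only finitely many sign sums have to be
  controlled at each step. By convexity \<open>\<Sum>i. a\<^sub>i y\<^sub>i\<close> is then equivalent to the supremum norm of \<open>a\<close>,
  which gives an isomorphic copy of \<open>c0\<close>.

  Conversely, in a separable space a copy of \<open>c0\<close> is complemented (Sobczyk). Following Veech,
  extend the coordinate functionals by Hahn-Banach to a bounded sequence \<open>f\<^sub>n\<close> and subtract
  functionals that vanish on the copy and are asymptotically equal to \<open>f\<^sub>n\<close>. Renorming the space
  as the \<open>\<ell>\<^sub>\<infinity>\<close>-sum of \<open>c0\<close> and a complement makes it almost square, the unit vectors of \<open>c0\<close> being
  the required sequence.
\<close>

subsection \<open>Hahn-Banach extension\<close>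

definition sublinear :: "('a::real_vector \<Rightarrow> real) \<Rightarrow> bool" where
  "sublinear p \<longleftrightarrow>
     (\<forall>x y. p (x + y) \<le> p x + p y) \<and> (\<forall>t\<ge>0. \<forall>x. p (t *\<^sub>R x) = t * p x)"

lemma sublinear_add: "sublinear p \<Longrightarrow> p (x + y) \<le> p x + p y"
  by (simp add: sublinear_def)

lemma sublinear_scale: "sublinear p \<Longrightarrow> 0 \<le> t \<Longrightarrow> p (t *\<^sub>R x) = t * p x"
  by (simp add: sublinear_def)

lemma sublinear_0: "sublinear p \<Longrightarrow> p 0 = 0"
  using sublinear_scale[of p 0 0] by simp

lemma sublinear_minus_le: "sublinear p \<Longrightarrow> - p (- x) \<le> p x"
  using sublinear_add[of p x "- x"] sublinear_0[of p] by simp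

text \<open>One inequality in the scaling law is enough: applied to \<open>t *\<^sub>R x\<close>
  with the factor \<open>inverse t\<close>, it yields the reverse one.\<close>

lemma sublinearI:
  assumes add: "\<And>x y. p (x + y) \<le> p x + p y"
    and zero: "p 0 = 0"
    and scale: "\<And>t x. 0 < t \<Longrightarrow> p (t *\<^sub>R x) \<le> t * p x"
  shows "sublinear p"
  unfolding sublinear_def
proof (intro conjI allI impI)
  fix t :: real and x
  assume "0 \<le> t"
  show "p (t *\<^sub>R x) = t * p x"
  proof (cases "t = 0")
    case False
    with \<open>0 \<le> t\<close> have t: "0 < t" by simp
    have "p (inverse t *\<^sub>R (t *\<^sub>R x)) \<le> inverse t * p (t *\<^sub>R x)"
      using t by (intro scale) simp
    then have "t * p x \<le> p (t *\<^sub>R x)"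
      using t by (simp add: field_simps)
    then show ?thesis
      using scale[OF t, of x] by simp
  qed (simp add: zero)
qed (rule add)

text \<open>If \<open>k\<close> competes for \<open>x\<close> and \<open>l\<close> for
  \<open>y\<close>, then \<open>k + l\<close> competes for \<open>x + y\<close>, so minimising a
  jointly sublinear \<open>h\<close> over a cone keeps it sublinear. Used with the half-line to
  perturb a minimal functional and with a subspace to build the Hahn-Banach majorant. The minorant
  \<open>L\<close> keeps the infima finite.\<close>

lemma sublinear_INF_cone:
  fixes h :: "'a::real_vector \<Rightarrow> 'b::real_vector \<Rightarrow> real"
  assumes K0: "0 \<in> K"
    and Kadd: "\<And>k l. k \<in> K \<Longrightarrow> l \<in> K \<Longrightarrow> k + l \<in> K"
    and Kscale: "\<And>t k. 0 < t \<Longrightarrow> k \<in> K \<Longrightarrow> t *\<^sub>R k \<in> K"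
    and h0: "h 0 0 = 0" "\<And>k. k \<in> K \<Longrightarrow> 0 \<le> h 0 k"
    and hadd: "\<And>x y k l. k \<in> K \<Longrightarrow> l \<in> K \<Longrightarrow> h (x + y) (k + l) \<le> h x k + h y l"
    and hscale: "\<And>t x k. 0 < t \<Longrightarrow> k \<in> K \<Longrightarrow> h (t *\<^sub>R x) (t *\<^sub>R k) = t * h x k"
    and below: "\<And>x k. k \<in> K \<Longrightarrow> L x \<le> h x k"
  shows "sublinear (\<lambda>x. INF k\<in>K. h x k)"
proof -
  have bdd: "bdd_below (h x ` K)" for x
    by (rule bdd_belowI2[where m = "L x"]) (rule below)
  have ne: "K \<noteq> {}"
    using K0 by blast
  have lower: "(INF k\<in>K. h x k) \<le> h x k" if "k \<in> K" for x k
    using cINF_lower[OF bdd that] .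
  show ?thesis
  proof (rule sublinearI)
    fix x y
    let ?s = "INF k\<in>K. h (x + y) k"
    have *: "?s \<le> h x k + h y l" if "k \<in> K" "l \<in> K" for k l
      using lower[OF Kadd[OF that], of "x + y"] hadd[OF that, of x y] by linarith
    have "?s - (INF l\<in>K. h y l) \<le> h x k" if "k \<in> K" for k
    proof -
      have "?s - h x k \<le> (INF l\<in>K. h y l)"
        using *[OF that] by (intro cINF_greatest[OF ne]) (simp add: algebra_simps)
      then show ?thesis by simp
    qed
    then have "?s - (INF l\<in>K. h y l) \<le> (INF k\<in>K. h x k)"
      by (rule cINF_greatest[OF ne])
    then show "?s \<le> (INF k\<in>K. h x k) + (INF k\<in>K. h y k)"
      by simp
  next
    show "(INF k\<in>K. h 0 k) = 0"
      using lower[OF K0, of 0] cINF_greatest[OF ne h0(2)] h0(1) by force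
  next
    fix t :: real and x
    assume t: "0 < t"
    have "(INF k\<in>K. h (t *\<^sub>R x) k) / t \<le> h x k" if "k \<in> K" for k
      using lower[OF Kscale[OF t that], of "t *\<^sub>R x"] hscale[OF t that, of x] t
      by (simp add: field_simps)
    then have "(INF k\<in>K. h (t *\<^sub>R x) k) / t \<le> (INF k\<in>K. h x k)"
      by (rule cINF_greatest[OF ne])
    then show "(INF k\<in>K. h (t *\<^sub>R x) k) \<le> t * (INF k\<in>K. h x k)"
      using t by (simp add: field_simps)
  qed
qed

text \<open>For subadditivity one needs a single member of the chain below both \<open>q\<close> and
  \<open>r\<close>; the smaller of the two serves. This provides the lower bounds for Zorn's
  lemma.\<close>

lemma sublinear_INF_chain:
  fixes C :: "('a::real_vector \<Rightarrow> real) set"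
  assumes ne: "C \<noteq> {}"
    and sub: "\<And>q. q \<in> C \<Longrightarrow> sublinear q"
    and chain: "\<And>q r. q \<in> C \<Longrightarrow> r \<in> C \<Longrightarrow> q \<le> r \<or> r \<le> q"
    and below: "\<And>q x. q \<in> C \<Longrightarrow> L x \<le> q x"
  shows "sublinear (\<lambda>x. INF q\<in>C. q x)"
proof -
  have bdd: "bdd_below ((\<lambda>q. q x) ` C)" for x
    by (rule bdd_belowI2[where m = "L x"]) (rule below)
  have lower: "(INF q\<in>C. q x) \<le> q x" if "q \<in> C" for x q
    using cINF_lower[OF bdd that] .
  show ?thesis
  proof (rule sublinearI)
    fix x y
    let ?s = "INF q\<in>C. q (x + y)"
    have *: "?s \<le> q x + r y" if q: "q \<in> C" and r: "r \<in> C" for q r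
      using chain[OF q r]
    proof
      assume "q \<le> r"
      then show ?thesis
        using lower[OF q, of "x + y"] sublinear_add[OF sub[OF q], of x y] le_funD[of q r y]
        by linarith
    next
      assume "r \<le> q"
      then show ?thesis
        using lower[OF r, of "x + y"] sublinear_add[OF sub[OF r], of x y] le_funD[of r q x]
        by linarith
    qed
    have "?s - (INF r\<in>C. r y) \<le> q x" if "q \<in> C" for q
    proof -
      have "?s - q x \<le> (INF r\<in>C. r y)"
        using *[OF that] by (intro cINF_greatest[OF ne]) (simp add: algebra_simps)
      then show ?thesis by simp
    qed
    then have "?s - (INF r\<in>C. r y) \<le> (INF q\<in>C. q x)"
      by (rule cINF_greatest[OF ne])
    then show "?s \<le> (INF q\<in>C. q x) + (INF q\<in>C. q y)"
      by simp
  next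
    have "(INF q\<in>C. q 0) = (INF q\<in>C. 0 :: real)"
      by (rule INF_cong) (simp_all add: sublinear_0[OF sub])
    with ne show "(INF q\<in>C. q 0) = 0"
      by simp
  next
    fix t :: real and x
    assume t: "0 < t"
    have "(INF q\<in>C. q (t *\<^sub>R x)) / t \<le> q x" if "q \<in> C" for q
      using lower[OF that, of "t *\<^sub>R x"] sublinear_scale[OF sub[OF that], of t x] t
      by (simp add: field_simps)
    then have "(INF q\<in>C. q (t *\<^sub>R x)) / t \<le> (INF q\<in>C. q x)"
      by (rule cINF_greatest[OF ne])
    then show "(INF q\<in>C. q (t *\<^sub>R x)) \<le> t * (INF q\<in>C. q x)"
      using t by (simp add: field_simps)
  qed
qed

text \<open>Tilting \<open>q\<close> along a direction \<open>a\<close>, that is, taking the infimum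
  of \<open>q (x + t *\<^sub>R a) - t * q a\<close> over \<open>t \<ge> 0\<close>, gives a sublinear
  function below \<open>q\<close>, hence \<open>q\<close> itself. The competitor
  \<open>t = 1\<close> at \<open>x = - a\<close> then forces \<open>q (- a) \<le> - q a\<close>; a
  sublinear odd function is linear.\<close>

lemma minimal_sublinear_imp_linear:
  assumes q: "sublinear q"
    and minimal: "\<And>r. sublinear r \<Longrightarrow> r \<le> q \<Longrightarrow> r = q"
  shows "linear q"
proof -
  have neg: "q (- a) = - q a" for a
  proof -
    let ?r = "\<lambda>x. INF t\<in>{0..}. q (x + t *\<^sub>R a) - t * q a"
    have below: "- q (- x) \<le> q (x + t *\<^sub>R a) - t * q a" if "0 \<le> t" for x t
      using sublinear_add[OF q, of "x + t *\<^sub>R a" "- x"] sublinear_scale[OF q that, of a]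
      by simp
    have r: "sublinear ?r"
    proof (rule sublinear_INF_cone[where L = "\<lambda>x. - q (- x)"])
      fix x y and k l :: real
      show "q (x + y + (k + l) *\<^sub>R a) - (k + l) * q a
          \<le> q (x + k *\<^sub>R a) - k * q a + (q (y + l *\<^sub>R a) - l * q a)"
        using sublinear_add[OF q, of "x + k *\<^sub>R a" "y + l *\<^sub>R a"]
        by (simp add: algebra_simps)
    next
      fix t k :: real and x
      assume "0 < t"
      then show "q (t *\<^sub>R x + (t *\<^sub>R k) *\<^sub>R a) - t *\<^sub>R k * q a = t * (q (x + k *\<^sub>R a) - k * q a)"
        using sublinear_scale[OF q, of t "x + k *\<^sub>R a"] by (simp add: algebra_simps)
    qed (use below sublinear_0[OF q] sublinear_scale[OF q] in auto)
    have lower: "?r x \<le> q (x + t *\<^sub>R a) - t * q a" if "0 \<le> t" for x t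
      using that below by (intro cINF_lower bdd_belowI2[where m = "- q (- x)"]) auto
    have "?r \<le> q"
      using lower[of 0] by (simp add: le_fun_def)
    then have "?r = q"
      by (rule minimal[OF r])
    then have "?r (- a) = q (- a)"
      by (rule fun_cong)
    with lower[of 1 "- a"] have "q (- a) \<le> q (- a + 1 *\<^sub>R a) - 1 * q a"
      by linarith
    then show ?thesis
      using sublinear_minus_le[OF q, of a] sublinear_0[OF q] by simp
  qed
  show ?thesis
  proof (rule linearI)
    fix x y
    show "q (x + y) = q x + q y"
      using sublinear_add[OF q, of x y] sublinear_add[OF q, of "x + y" "- y"] neg[of y] by simp
  next
    fix t :: real and x
    show "q (t *\<^sub>R x) = t *\<^sub>R q x"
      using sublinear_scale[OF q, of t x] sublinear_scale[OF q, of "- t" x] neg[of "t *\<^sub>R x"]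
      by (cases "0 \<le> t") auto
  qed
qed

text \<open>Zorn's lemma for the reversed pointwise order gives a minimal sublinear function below
  \<open>p\<close>. It is minimal among all sublinear functions, since whatever lies below it also
  lies below \<open>p\<close>.\<close>

lemma sublinear_dominates_linear:
  assumes p: "sublinear p"
  obtains f where "linear f" "f \<le> p"
proof -
  define A where "A = {q. sublinear q \<and> q \<le> p}"
  have "\<exists>m\<in>A. \<forall>a\<in>A. a \<le> m \<longrightarrow> a = m"
  proof (rule predicate_Zorn)
    show "partial_order_on A (relation_of (\<lambda>q r. r \<le> q) A)"
      by (rule partial_order_on_relation_ofI) auto
  next
    fix C
    assume C: "C \<in> Chains (relation_of (\<lambda>q r. r \<le> q) A)"
    then have CA: "C \<subseteq> A" and chain: "\<And>q r. q \<in> C \<Longrightarrow> r \<in> C \<Longrightarrow> q \<le> r \<or> r \<le> q"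
      by (auto simp: Chains_def relation_of_def)
    show "\<exists>u\<in>A. \<forall>a\<in>C. u \<le> a"
    proof (cases "C = {}")
      case True
      then show ?thesis
        using p by (auto simp: A_def)
    next
      case False
      let ?u = "\<lambda>x. INF q\<in>C. q x"
      \<comment> \<open>A minorant common to the whole chain, so that the pointwise infima are
        finite.\<close>
      have below: "- p (- x) \<le> q x" if "q \<in> C" for q x
      proof -
        have "sublinear q" "q (- x) \<le> p (- x)"
          using that CA by (auto simp: A_def le_fun_def)
        then show ?thesis
          using sublinear_minus_le[of q x] by linarith
      qed
      have lower: "?u \<le> q" if "q \<in> C" for q
      proof (rule le_funI)
        fix x
        show "(INF q\<in>C. q x) \<le> q x"
          using that below by (intro cINF_lower bdd_belowI2[where m = "- p (- x)"])
      qed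
      have "sublinear ?u"
        using False CA chain below
        by (intro sublinear_INF_chain[where L = "\<lambda>x. - p (- x)"]) (auto simp: A_def)
      moreover have "?u \<le> p"
      proof -
        from False obtain q where q: "q \<in> C"
          by blast
        with CA have "q \<le> p"
          by (auto simp: A_def)
        with lower[OF q] show ?thesis
          by (rule order_trans)
      qed
      ultimately show ?thesis
        using lower unfolding A_def by blast
    qed
  qed
  then obtain m where m: "m \<in> A" "\<And>a. a \<in> A \<Longrightarrow> a \<le> m \<Longrightarrow> a = m"
    by blast
  then have "linear m"
    unfolding A_def by (intro minimal_sublinear_imp_linear) auto
  with m(1) show thesis
    using that by (auto simp: A_def)
qed

text \<open>The infimal convolution \<open>?p\<close> is the largest sublinear function lying below
  \<open>C * norm x\<close> everywhere and below \<open>\<phi>\<close> on \<open>Y\<close>. Any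
  linear \<open>f \<le> ?p\<close> works: \<open>y = 0\<close> gives the norm bound,
  \<open>x = y\<close> gives \<open>f \<le> \<phi>\<close> on \<open>Y\<close>, and passing to
  \<open>- y\<close> turns this into equality.\<close>

theorem Hahn_Banach_norm:
  fixes \<phi> :: "'a::real_normed_vector \<Rightarrow> real"
  assumes Y: "subspace Y"
    and add: "\<And>x y. x \<in> Y \<Longrightarrow> y \<in> Y \<Longrightarrow> \<phi> (x + y) = \<phi> x + \<phi> y"
    and scale: "\<And>t x. x \<in> Y \<Longrightarrow> \<phi> (t *\<^sub>R x) = t * \<phi> x"
    and bound: "\<And>x. x \<in> Y \<Longrightarrow> \<bar>\<phi> x\<bar> \<le> C * norm x"
    and C: "0 \<le> C"
  obtains f where "linear f" "\<And>x. \<bar>f x\<bar> \<le> C * norm x" "\<And>y. y \<in> Y \<Longrightarrow> f y = \<phi> y"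
proof -
  let ?h = "\<lambda>x y. C * norm (x - y) + \<phi> y"
  let ?p = "\<lambda>x. INF y\<in>Y. ?h x y"
  have \<phi>0: "\<phi> 0 = 0"
    using scale[of 0 0] Y by (simp add: subspace_0)
  have below: "- (C * norm x) \<le> ?h x y" if "y \<in> Y" for x y
  proof -
    have "C * norm y \<le> C * (norm (x - y) + norm x)"
      using C norm_triangle_ineq4[of x "x - y"] by (intro mult_left_mono) auto
    then show ?thesis
      using bound[OF that] by (simp add: algebra_simps)
  qed
  have "sublinear ?p"
  proof (rule sublinear_INF_cone[where L = "\<lambda>x. - (C * norm x)"])
    fix x y k l
    assume kl: "k \<in> Y" "l \<in> Y"
    have "C * norm (x + y - (k + l)) \<le> C * (norm (x - k) + norm (y - l))"
      using C norm_triangle_ineq[of "x - k" "y - l"]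
      by (intro mult_left_mono) (auto simp: algebra_simps)
    then show "?h (x + y) (k + l) \<le> ?h x k + ?h y l"
      using add[OF kl] by (simp add: algebra_simps)
  next
    fix t :: real and x k
    assume "0 < t" "k \<in> Y"
    then show "?h (t *\<^sub>R x) (t *\<^sub>R k) = t * ?h x k"
      using scale[of k t] by (simp add: algebra_simps flip: scaleR_diff_right)
  qed (use Y below[of _ 0] \<phi>0 below in
      \<open>auto simp: subspace_0 subspace_add subspace_scale\<close>)
  then obtain f where f: "linear f" "f \<le> ?p"
    by (rule sublinear_dominates_linear)
  have le: "f x \<le> ?h x y" if "y \<in> Y" for x y
  proof -
    have "?p x \<le> ?h x y"
      using that below by (intro cINF_lower bdd_belowI2[where m = "- (C * norm x)"]) auto
    then show ?thesis
      using f(2) by (meson le_funD order_trans)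
  qed
  show thesis
  proof
    show "linear f" by (rule f(1))
    show "\<bar>f x\<bar> \<le> C * norm x" for x
      using le[of 0 x] le[of 0 "- x"] Y \<phi>0 linear_neg[OF f(1), of x]
      by (simp add: subspace_0)
    show "f y = \<phi> y" if "y \<in> Y" for y
      using le[OF that, of y] le[of "- y" "- y"] that Y linear_neg[OF f(1), of y] scale[OF that, of "-1"]
      by (simp add: subspace_neg)
  qed
qed

subsection \<open>Approximation by vanishing functionals\<close>

text \<open>Tychonoff's theorem for the product of the intervals \<open>{- B x..B x}\<close>. The
  limit is taken along a filter, because this product need not be sequentially compact.\<close>

lemma pointwise_bounded_cluster_filter:
  fixes f :: "'i \<Rightarrow> 'a \<Rightarrow> real"
  assumes "G \<noteq> bot" and bound: "\<And>n x. \<bar>f n x\<bar> \<le> B x"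
  obtains g H where "H \<noteq> bot" "H \<le> filtermap f G" "\<And>x. ((\<lambda>h. h x) \<longlongrightarrow> g x) H"
proof -
  let ?K = "PiE UNIV (\<lambda>x. {- B x..B x})"
  have "compactin (product_topology (\<lambda>x. euclidean) UNIV) ?K"
    by (simp add: compactin_PiE)
  then have "compact ?K"
    by (simp add: euclidean_product_topology)
  moreover have "eventually (\<lambda>h. h \<in> ?K) (filtermap f G)"
    using bound by (auto simp: eventually_filtermap PiE_def abs_le_iff minus_le_iff)
  ultimately obtain g where g: "inf (nhds g) (filtermap f G) \<noteq> bot"
    using \<open>G \<noteq> bot\<close> unfolding compact_filter by (metis filtermap_bot_iff)
  have "((\<lambda>h. h x) \<longlongrightarrow> g x) (inf (nhds g) (filtermap f G))" for x
  proof -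
    have "((\<lambda>h. h x) \<longlongrightarrow> g x) (at g)"
      using continuous_on_product_coordinates[of x] unfolding continuous_on_def by blast
    then have "((\<lambda>h. h x) \<longlongrightarrow> g x) (nhds g)"
      using tendsto_at_iff_tendsto_nhds[of "\<lambda>h. h x" g] by simp
    then show ?thesis
      by (rule tendsto_mono[rotated]) simp
  qed
  with g show thesis
    by (intro that) auto
qed

text \<open>The common bound makes the \<open>f n\<close> equicontinuous, so convergence passes from
  a dense set to its closure.\<close>

lemma tendsto_0_dense:
  fixes f :: "nat \<Rightarrow> 'a::real_normed_vector \<Rightarrow> real"
  assumes lin: "\<And>n. linear (f n)"
    and bound: "\<And>n x. \<bar>f n x\<bar> \<le> C * norm x"
    and dense: "closure D = UNIV"
    and lim: "\<And>x. x \<in> D \<Longrightarrow> (\<lambda>n. f n x) \<longlonglongrightarrow> 0"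
  shows "(\<lambda>n. f n x) \<longlonglongrightarrow> 0"
proof (rule tendstoI)
  fix e :: real
  assume e: "0 < e"
  define \<delta> where "\<delta> = e / (2 * (\<bar>C\<bar> + 1))"
  have \<delta>: "0 < \<delta>" "(\<bar>C\<bar> + 1) * \<delta> = e / 2"
    using e by (auto simp: \<delta>_def field_simps)
  have "x \<in> closure D"
    using dense by simp
  then obtain d where d: "d \<in> D" "dist d x < \<delta>"
    using \<delta>(1) closure_approachable by metis
  have close: "\<bar>f n x - f n d\<bar> \<le> e / 2" for n
  proof -
    have "\<bar>f n x - f n d\<bar> \<le> C * norm (x - d)"
      using bound[of n "x - d"] by (simp add: linear_diff[OF lin])
    also have "\<dots> \<le> (\<bar>C\<bar> + 1) * \<delta>"
      using d(2) by (intro mult_mono) (auto simp: dist_norm norm_minus_commute)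
    finally show ?thesis
      by (simp only: \<delta>)
  qed
  have "eventually (\<lambda>n. dist (f n d) 0 < e / 2) sequentially"
    using lim[OF d(1)] e by (intro tendstoD) auto
  then show "eventually (\<lambda>n. dist (f n x) 0 < e) sequentially"
  proof eventually_elim
    case (elim n)
    then show ?case
      using close[of n] unfolding dist_real_def by linarith
  qed
qed

text \<open>Take for \<open>\<kappa> n\<close> the largest \<open>k \<le> n\<close> with
  \<open>P k n\<close>: the cap \<open>n\<close> makes the set finite, \<open>P 0 n\<close> makes it
  nonempty, and each fixed \<open>k\<close> belongs to it for all large \<open>n\<close>.\<close>

lemma eventually_diagonal:
  fixes P :: "nat \<Rightarrow> nat \<Rightarrow> bool"
  assumes "\<And>n. P 0 n" and "\<And>k. eventually (P k) sequentially"
  obtains \<kappa> where "\<And>n. P (\<kappa> n) n" "filterlim \<kappa> at_top sequentially"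
proof -
  define \<kappa> where "\<kappa> n = Max {k. k \<le> n \<and> P k n}" for n
  have fin: "finite {k. k \<le> n \<and> P k n}" for n
    by simp
  show thesis
  proof
    show "P (\<kappa> n) n" for n
      using Max_in[OF fin, of n] assms(1)[of n] unfolding \<kappa>_def by blast
    show "filterlim \<kappa> at_top sequentially"
      unfolding filterlim_at_top
    proof
      fix k
      show "eventually (\<lambda>n. k \<le> \<kappa> n) sequentially"
        using assms(2)[of k] eventually_ge_at_top[of k]
        by eventually_elim (auto simp: \<kappa>_def intro!: Max_ge)
    qed
  qed
qed

text \<open>
  Veech's step in the proof of Sobczyk's theorem: every pointwise cluster point of \<open>f\<close> vanishes
  on \<open>Y\<close>, so by compactness \<open>f n\<close> gets arbitrarily close to such functionals on any finite part of a
  countable dense set.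
\<close>

lemma vanishing_functionals_approx:
  fixes f :: "nat \<Rightarrow> 'a::real_normed_vector \<Rightarrow> real"
  assumes separable: "separable_space (euclidean :: 'a topology)"
    and lin: "\<And>n. linear (f n)"
    and bound: "\<And>n x. \<bar>f n x\<bar> \<le> C * norm x"
    and lim: "\<And>y. y \<in> Y \<Longrightarrow> (\<lambda>n. f n y) \<longlonglongrightarrow> 0"
  obtains g where "\<And>n. linear (g n)" "\<And>n x. \<bar>g n x\<bar> \<le> C * norm x"
    "\<And>n y. y \<in> Y \<Longrightarrow> g n y = 0" "\<And>x. (\<lambda>n. f n x - g n x) \<longlonglongrightarrow> 0"
proof -
  obtain D :: "'a set" where D: "countable D" "closure D = UNIV"
    using separable unfolding separable_space_def by auto
  then have "D \<noteq> {}"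
    by auto
  define d where "d = from_nat_into D"
  have range_d: "range d = D"
    using D(1) \<open>D \<noteq> {}\<close> unfolding d_def by (rule range_from_nat_into[rotated])
  define F where "F = {g. linear g \<and> (\<forall>x. \<bar>g x\<bar> \<le> C * norm x) \<and> (\<forall>y\<in>Y. g y = 0)}"
  \<comment> \<open>Growing \<open>k\<close> both enlarges the finite test set and tightens the
    tolerance; \<open>k = 0\<close> tests nothing, as \<open>eventually_diagonal\<close>
    requires.\<close>
  define P where "P k n \<longleftrightarrow> (\<exists>g\<in>F. \<forall>i<k. \<bar>f n (d i) - g (d i)\<bar> < 1 / Suc k)" for k n
  have "(\<lambda>x. 0) \<in> F"
  proof -
    have "0 \<le> C * norm x" for x :: 'a
      using bound[of 0 x] by linarith
    then show ?thesis
      by (simp add: F_def linear_zero)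
  qed
  then have P0: "P 0 n" for n
    by (auto simp: P_def)
  have ev: "eventually (P k) sequentially" for k
  proof (rule ccontr)
    assume "\<not> eventually (P k) sequentially"
    \<comment> \<open>If \<open>P k\<close> fails infinitely often, the bad indices carry a proper
      filter, along which \<open>f\<close> has a cluster point \<open>g\<close>.\<close>
    then have "inf sequentially (principal {n. \<not> P k n}) \<noteq> bot"
      by (simp add: trivial_limit_def eventually_inf_principal)
    then obtain g H where H: "H \<noteq> bot"
      "H \<le> filtermap f (inf sequentially (principal {n. \<not> P k n}))"
      and conv: "\<And>x. ((\<lambda>h. h x) \<longlongrightarrow> g x) H"
      using pointwise_bounded_cluster_filter[of _ f, OF _ bound] by blast
    have evH: "eventually Q H"
      if "eventually (\<lambda>n. \<not> P k n \<longrightarrow> Q (f n)) sequentially" for Q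
      using that by (intro filter_leD[OF H(2)]) (simp add: eventually_filtermap eventually_inf_principal)
    have lim0: "((\<lambda>h. h y) \<longlongrightarrow> 0) H" if "y \<in> Y" for y
    proof (rule tendstoI)
      fix e :: real
      assume "0 < e"
      then show "eventually (\<lambda>h. dist (h y) 0 < e) H"
        using tendstoD[OF lim[OF that], of e] by (intro evH) (auto elim: eventually_mono)
    qed
    have "g \<in> F"
      unfolding F_def
    proof (intro CollectI conjI allI ballI)
      have evlin: "eventually linear H"
        using lin by (intro evH) auto
      show "linear g"
      proof (rule linearI)
        fix x y
        have "((\<lambda>h. h (x + y)) \<longlongrightarrow> g x + g y) H"
          using tendsto_add[OF conv[of x] conv[of y]]
          by (rule Lim_transform_eventually) (use evlin in \<open>auto elim!: eventually_mono simp: linear_add\<close>)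
        then show "g (x + y) = g x + g y"
          using tendsto_unique[OF H(1) conv] by blast
      next
        fix t x
        have "((\<lambda>h. h (t *\<^sub>R x)) \<longlongrightarrow> t *\<^sub>R g x) H"
          using tendsto_scaleR[OF tendsto_const conv[of x]]
          by (rule Lim_transform_eventually) (use evlin in \<open>auto elim!: eventually_mono simp: linear_scale\<close>)
        then show "g (t *\<^sub>R x) = t *\<^sub>R g x"
          using tendsto_unique[OF H(1) conv] by blast
      qed
      show "\<bar>g x\<bar> \<le> C * norm x" for x
        using bound by (intro tendsto_upperbound[OF tendsto_rabs[OF conv[of x]] _ H(1)] evH) auto
      show "g y = 0" if "y \<in> Y" for y
        using tendsto_unique[OF H(1) conv lim0[OF that]] .
    qed
    \<comment> \<open>Near the cluster point there is an \<open>f n\<close> with \<open>n\<close>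
      bad that is close to \<open>g\<close> at the first \<open>k\<close> points; as
      \<open>g\<close> lies in \<open>F\<close>, it witnesses \<open>P k n\<close>, a
      contradiction.\<close>
    have "eventually (\<lambda>h. \<bar>h (d i) - g (d i)\<bar> < 1 / Suc k) H" for i
      using tendstoD[OF conv[of "d i"], of "1 / Suc k"] by (simp add: dist_real_def)
    then have "eventually (\<lambda>h. \<forall>i\<in>{..<k}. \<bar>h (d i) - g (d i)\<bar> < 1 / Suc k) H"
      by (intro eventually_ball_finite) auto
    moreover have "eventually (\<lambda>h. \<exists>n. h = f n \<and> \<not> P k n) H"
      by (intro evH always_eventually) blast
    ultimately have "eventually (\<lambda>h. False) H"
      by eventually_elim (use \<open>g \<in> F\<close> in \<open>auto simp: P_def\<close>)
    with H(1) show False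
      by simp
  qed
  obtain \<kappa> where \<kappa>: "\<And>n. P (\<kappa> n) n" "filterlim \<kappa> at_top sequentially"
    using eventually_diagonal[of P] P0 ev by blast
  then obtain g where g: "\<And>n. g n \<in> F"
    "\<And>n i. i < \<kappa> n \<Longrightarrow> \<bar>f n (d i) - g n (d i)\<bar> < 1 / Suc (\<kappa> n)"
    unfolding P_def by metis
  have glin: "linear (g n)" and gbound: "\<bar>g n x\<bar> \<le> C * norm x" and "y \<in> Y \<Longrightarrow> g n y = 0" for n x y
    using g(1)[of n] by (auto simp: F_def)
  moreover have "(\<lambda>n. f n x - g n x) \<longlonglongrightarrow> 0" for x
  proof (rule tendsto_0_dense[OF _ _ D(2)])
    show "linear (\<lambda>x. f n x - g n x)" for n
      using lin glin by (rule linear_compose_sub)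
    show "\<bar>f n x - g n x\<bar> \<le> (2 * C) * norm x" for n x
      using bound[of n x] gbound[of n x] by linarith
    fix x
    assume "x \<in> D"
    then obtain i where i: "x = d i"
      using range_d by auto
    show "(\<lambda>n. f n x - g n x) \<longlonglongrightarrow> 0"
    proof (rule tendstoI)
      fix e :: real
      assume "0 < e"
      then obtain k :: nat where k: "1 / Suc k < e"
        using nat_approx_posE by blast
      \<comment> \<open>\<open>Suc i\<close> puts the point \<open>d i\<close> among those tested at
        stage \<open>\<kappa> n\<close>; \<open>k\<close> brings the tolerance below
        \<open>e\<close>.\<close>
      have "eventually (\<lambda>n. max (Suc i) k \<le> \<kappa> n) sequentially"
        using \<kappa>(2) unfolding filterlim_at_top by blast
      then show "eventually (\<lambda>n. dist (f n x - g n x) 0 < e) sequentially"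
      proof eventually_elim
        case (elim n)
        then have "1 / Suc (\<kappa> n) \<le> 1 / Suc k"
          by (intro divide_left_mono) auto
        then show ?case
          using g(2)[of i n] elim k i by (auto simp: dist_real_def)
      qed
    qed
  qed
  ultimately show thesis
    by (rule that)
qed

subsection \<open>Almost square norms yield copies of c0\<close>

lemma is_norm_simps:
  assumes "is_norm N"
  shows is_norm_0: "N 0 = 0"
    and is_norm_eq_0: "N x = 0 \<longleftrightarrow> x = 0"
    and is_norm_scale: "N (a *\<^sub>R x) = \<bar>a\<bar> * N x"
    and is_norm_triangle: "N (x + y) \<le> N x + N y"
  using assms by (auto simp: is_norm_def)

lemma is_norm_minus: "is_norm N \<Longrightarrow> N (- x) = N x"
  using is_norm_scale[of N "-1" x] by simp

lemma is_norm_nonneg: "is_norm N \<Longrightarrow> 0 \<le> N x"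
  using is_norm_triangle[of N x "- x"] is_norm_0[of N] is_norm_minus[of N x] by simp

text \<open>Expand in \<open>x + y\<close> and \<open>x - y\<close>: the coefficients
  \<open>(a + b) / 2\<close> and \<open>(a - b) / 2\<close> have absolute values summing to
  \<open>max \<bar>a\<bar> \<bar>b\<bar>\<close>. This is the convexity fact that the square is the
  hull of its four corners.\<close>

lemma is_norm_combination_le:
  assumes N: "is_norm N"
  shows "N (a *\<^sub>R x + b *\<^sub>R y) \<le> max \<bar>a\<bar> \<bar>b\<bar> * max (N (x + y)) (N (x - y))"
proof -
  let ?M = "max (N (x + y)) (N (x - y))"
  have "((a + b) / 2) *\<^sub>R (x + y) + ((a - b) / 2) *\<^sub>R (x - y) =
      ((a + b) / 2 + (a - b) / 2) *\<^sub>R x + ((a + b) / 2 - (a - b) / 2) *\<^sub>R y"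
    by (simp only: scaleR_add_left scaleR_diff_left scaleR_add_right scaleR_diff_right) simp
  also have "(a + b) / 2 + (a - b) / 2 = a"
    by (simp add: field_simps)
  also have "(a + b) / 2 - (a - b) / 2 = b"
    by (simp add: field_simps)
  finally have "N (a *\<^sub>R x + b *\<^sub>R y) \<le> \<bar>(a + b) / 2\<bar> * N (x + y) + \<bar>(a - b) / 2\<bar> * N (x - y)"
    using is_norm_triangle[OF N, of "((a + b) / 2) *\<^sub>R (x + y)" "((a - b) / 2) *\<^sub>R (x - y)"]
    by (simp only: is_norm_scale[OF N])
  also have "\<dots> \<le> \<bar>(a + b) / 2\<bar> * ?M + \<bar>(a - b) / 2\<bar> * ?M"
    by (intro add_mono mult_left_mono) auto
  also have "\<dots> = (\<bar>(a + b) / 2\<bar> + \<bar>(a - b) / 2\<bar>) * ?M"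
    by (simp add: algebra_simps)
  also have "\<bar>(a + b) / 2\<bar> + \<bar>(a - b) / 2\<bar> = max \<bar>a\<bar> \<bar>b\<bar>"
    by (auto simp: max_def abs_if field_simps)
  finally show ?thesis .
qed

text \<open>Almost squareness speaks of unit vectors only, so nonzero \<open>x\<close> is written as
  \<open>N x\<close> times a unit vector. By \<open>is_norm_combination_le\<close> the norms of
  \<open>x \<plusminus> y n\<close> are bounded by a sequence tending to
  \<open>max (N x) 1 < K\<close>. Strict inequalities make the conditions for the finitely many
  \<open>x\<close> hold simultaneously for large \<open>n\<close>.\<close>

lemma almost_square_extend:
  assumes N: "is_norm N" and asq: "almost_square N" and F: "finite F"
    and K: "1 < K" "\<And>x. x \<in> F \<Longrightarrow> N x < K" and c: "c < 1"
  obtains y where "c < N y" "\<And>x. x \<in> F \<Longrightarrow> N (x + y) < K \<and> N (x - y) < K"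
proof -
  define u where "u x = inverse (N x) *\<^sub>R x" for x
  have Npos: "0 < N x" if "x \<noteq> 0" for x
    using is_norm_nonneg[OF N, of x] is_norm_eq_0[OF N, of x] that by simp
  have xu: "x = N x *\<^sub>R u x" if "x \<noteq> 0" for x
    using Npos[OF that] by (simp add: u_def)
  have "u ` (F - {0}) \<subseteq> {x. N x = 1}"
  proof (intro image_subsetI CollectI)
    fix x
    assume "x \<in> F - {0}"
    then show "N (u x) = 1"
      using Npos[of x] by (simp add: u_def is_norm_scale[OF N])
  qed
  moreover have "finite (u ` (F - {0}))"
    using F by simp
  ultimately have "\<exists>y. range y \<subseteq> {x. N x \<le> 1} \<and>
      (\<forall>v\<in>u ` (F - {0}). (\<lambda>n. N (v + y n)) \<longlonglongrightarrow> 1 \<and> (\<lambda>n. N (v - y n)) \<longlonglongrightarrow> 1) \<and>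
      (\<lambda>n. N (y n)) \<longlonglongrightarrow> 1"
    using asq by (simp only: almost_square_def simp_thms)
  then obtain y where range_y: "range y \<subseteq> {x. N x \<le> 1}"
    and yu_conj: "\<forall>v\<in>u ` (F - {0}). (\<lambda>n. N (v + y n)) \<longlonglongrightarrow> 1 \<and> (\<lambda>n. N (v - y n)) \<longlonglongrightarrow> 1"
    and y_lim: "(\<lambda>n. N (y n)) \<longlonglongrightarrow> 1"
    by (elim exE conjE)
  have y_le: "N (y n) \<le> 1" for n
    using range_y by auto
  have yu: "(\<lambda>n. N (u x + y n)) \<longlonglongrightarrow> 1" "(\<lambda>n. N (u x - y n)) \<longlonglongrightarrow> 1" if "x \<in> F" "x \<noteq> 0" for x
    using yu_conj that by auto
  have "eventually (\<lambda>n. N (x + y n) < K \<and> N (x - y n) < K) sequentially" if "x \<in> F" for x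
  proof (cases "x = 0")
    case True
    have "N (y n) < K" for n
      using y_le[of n] K(1) by linarith
    with True show ?thesis
      by (simp add: is_norm_minus[OF N])
  next
    case False
    let ?r = "\<lambda>n. max \<bar>N x\<bar> \<bar>1\<bar> * max (N (u x + y n)) (N (u x - y n))"
    have le: "N (x + y n) \<le> ?r n" "N (x - y n) \<le> ?r n" for n
      using is_norm_combination_le[OF N, of "N x" "u x" 1 "y n"]
        is_norm_combination_le[OF N, of "N x" "u x" "-1" "y n"] xu[OF False] by simp_all
    have "?r \<longlonglongrightarrow> max \<bar>N x\<bar> \<bar>1\<bar> * max 1 1"
      using that False by (intro tendsto_intros yu) auto
    moreover have "max \<bar>N x\<bar> \<bar>1\<bar> * max 1 1 < K"
      using K(1) K(2)[OF that] is_norm_nonneg[OF N, of x] by simp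
    ultimately have "eventually (\<lambda>n. ?r n < K) sequentially"
      by (rule order_tendstoD)
    then show ?thesis
      by eventually_elim (use le in \<open>auto intro: le_less_trans\<close>)
  qed
  then have "eventually (\<lambda>n. \<forall>x\<in>F. N (x + y n) < K \<and> N (x - y n) < K) sequentially"
    using F by (intro eventually_ball_finite) auto
  moreover have "eventually (\<lambda>n. c < N (y n)) sequentially"
    using order_tendstoD(1)[OF y_lim c] .
  ultimately have "eventually (\<lambda>n. c < N (y n) \<and> (\<forall>x\<in>F. N (x + y n) < K \<and> N (x - y n) < K)) sequentially"
    by eventually_elim auto
  then obtain n where "c < N (y n) \<and> (\<forall>x\<in>F. N (x + y n) < K \<and> N (x - y n) < K)"
    using eventually_happens'[OF sequentially_bot] by blast
  then show thesis
    using that by blast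
qed

lemma almost_square_sign_sequence:
  fixes N :: "'a::real_vector \<Rightarrow> real"
  assumes N: "is_norm N" and asq: "almost_square N" and K: "1 < K" and c: "c < 1"
  obtains y :: "nat \<Rightarrow> 'a" where "\<And>n. c < N (y n)"
    "\<And>n \<epsilon>. (\<And>i. \<bar>\<epsilon> i\<bar> = 1) \<Longrightarrow> N (\<Sum>i<n. \<epsilon> i *\<^sub>R y i) < K"
proof -
  \<comment> \<open>\<open>S\<close> is to contain all sign sums of the first \<open>n\<close>
    vectors; the last clause supplies the empty sum at the start of the recursion.\<close>
  define P where "P n S \<longleftrightarrow> finite S \<and> (\<forall>s\<in>S. N s < K) \<and> (n = 0 \<longrightarrow> 0 \<in> S)"
    for n :: nat and S
  define Q where "Q S S' y \<longleftrightarrow> c < N y \<and> S' = (\<lambda>s. s + y) ` S \<union> (\<lambda>s. s - y) ` S" for S S' y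
  have "\<exists>S. \<forall>n. P n (S n) \<and> (\<exists>y. Q (S n) (S (Suc n)) y)"
  proof (rule dependent_nat_choice)
    show "\<exists>S. P 0 S"
      using K by (intro exI[of _ "{0}"]) (simp add: P_def is_norm_0[OF N])
  next
    fix S n
    assume P: "P n S"
    then obtain y where y: "c < N y" "\<And>s. s \<in> S \<Longrightarrow> N (s + y) < K \<and> N (s - y) < K"
      using almost_square_extend[OF N asq _ K _ c, of S] unfolding P_def by blast
    then have "P (Suc n) ((\<lambda>s. s + y) ` S \<union> (\<lambda>s. s - y) ` S)"
      using P by (auto simp: P_def)
    with y(1) show "\<exists>S'. P (Suc n) S' \<and> (\<exists>y. Q S S' y)"
      unfolding Q_def by blast
  qed
  then obtain S y where S: "\<And>n. P n (S n)" and Q: "\<And>n. Q (S n) (S (Suc n)) (y n)"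
    by metis
  have S0: "0 \<in> S 0" and SK: "\<And>n s. s \<in> S n \<Longrightarrow> N s < K"
    using S unfolding P_def by auto
  have y: "c < N (y n)" and S_Suc: "S (Suc n) = (\<lambda>s. s + y n) ` S n \<union> (\<lambda>s. s - y n) ` S n" for n
    using Q[of n] by (auto simp: Q_def)
  have "(\<Sum>i<n. \<epsilon> i *\<^sub>R y i) \<in> S n" if "\<And>i. \<bar>\<epsilon> i\<bar> = 1" for n and \<epsilon> :: "nat \<Rightarrow> real"
  proof (induction n)
    case (Suc n)
    have "\<epsilon> n = 1 \<or> \<epsilon> n = -1"
      using that[of n] by linarith
    with Suc show ?case
      by (auto simp: S_Suc)
  qed (simp add: S0)
  then show thesis
    using that[of y] y SK by blast
qed

text \<open>A convex function on a cube is bounded by its values at the vertices. The induction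
  frees one coefficient at a time; the offset \<open>z\<close> is general so that it can absorb the
  term already treated.\<close>

lemma sign_sums_bound:
  fixes y :: "nat \<Rightarrow> 'a::real_vector"
  assumes N: "is_norm N"
    and "\<forall>\<epsilon>. (\<forall>i. \<bar>\<epsilon> i\<bar> = 1) \<longrightarrow> N (z + (\<Sum>i<n. \<epsilon> i *\<^sub>R y i)) \<le> K"
    and "\<forall>i<n. \<bar>a i\<bar> \<le> 1"
  shows "N (z + (\<Sum>i<n. a i *\<^sub>R y i)) \<le> K"
  using assms(2,3)
proof (induction n arbitrary: z)
  case 0
  from "0.prems"(1)[THEN spec, of "\<lambda>_. 1"] show ?case by simp
next
  case (Suc n)
  have "N ((z + a n *\<^sub>R y n) + (\<Sum>i<n. a i *\<^sub>R y i)) \<le> K"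
  proof (rule Suc.IH, intro allI impI)
    fix \<epsilon> :: "nat \<Rightarrow> real"
    assume \<epsilon>: "\<forall>i. \<bar>\<epsilon> i\<bar> = 1"
    let ?w = "z + (\<Sum>i<n. \<epsilon> i *\<^sub>R y i)"
    \<comment> \<open>Both signs of the last term are available, which is what interpolation to
      \<open>a n\<close> needs.\<close>
    have "N (z + (\<Sum>i<Suc n. (\<epsilon>(n := t)) i *\<^sub>R y i)) \<le> K" if "\<bar>t\<bar> = 1" for t
      using \<epsilon> that by (intro Suc.prems(1)[rule_format]) auto
    from this[of 1] this[of "-1"] have "max (N (?w + y n)) (N (?w - y n)) \<le> K"
      by (simp add: algebra_simps)
    moreover have "max \<bar>1\<bar> \<bar>a n\<bar> = 1"
      using Suc.prems(2) by simp
    ultimately have "N (?w + a n *\<^sub>R y n) \<le> K"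
      using is_norm_combination_le[OF N, of 1 ?w "a n" "y n"] by (simp add: order_trans)
    then show "N ((z + a n *\<^sub>R y n) + (\<Sum>i<n. \<epsilon> i *\<^sub>R y i)) \<le> K"
      by (simp add: algebra_simps)
  qed (use Suc.prems(2) in auto)
  then show ?case
    by (simp add: algebra_simps)
qed

lemma almost_square_c0_sequence:
  fixes N :: "'a::real_vector \<Rightarrow> real"
  assumes N: "is_norm N" and asq: "almost_square N"
  obtains y :: "nat \<Rightarrow> 'a" where
    "\<forall>n a c. 0 \<le> c \<longrightarrow> (\<forall>i<n. \<bar>a i\<bar> \<le> c) \<longrightarrow> N (\<Sum>i<n. a i *\<^sub>R y i) \<le> 3 / 2 * c"
    "\<forall>n a. \<forall>j<n. \<bar>a j\<bar> \<le> 4 * N (\<Sum>i<n. a i *\<^sub>R y i)"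
proof -
  obtain y :: "nat \<Rightarrow> 'a" where y: "\<And>n. 7 / 8 < N (y n)"
    and sign: "\<And>n \<epsilon>. (\<And>i. \<bar>\<epsilon> i\<bar> = 1) \<Longrightarrow> N (\<Sum>i<n. \<epsilon> i *\<^sub>R y i) < 3 / 2"
    using almost_square_sign_sequence[OF N asq, of "3 / 2" "7 / 8"] by auto
  have upper: "N (\<Sum>i<n. a i *\<^sub>R y i) \<le> 3 / 2 * c"
    if "0 \<le> c" and a: "\<And>i. i < n \<Longrightarrow> \<bar>a i\<bar> \<le> c" for n a c
  proof (cases "c = 0")
    case True
    with a have "(\<Sum>i<n. a i *\<^sub>R y i) = 0"
      by (intro sum.neutral) auto
    with True show ?thesis
      by (simp add: is_norm_0[OF N])
  next
    case False
    with \<open>0 \<le> c\<close> have c: "0 < c" by simp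
    have "N (0 + (\<Sum>i<n. (a i / c) *\<^sub>R y i)) \<le> 3 / 2"
      using sign a c by (intro sign_sums_bound[OF N]) (auto intro: less_imp_le)
    moreover have "(\<Sum>i<n. a i *\<^sub>R y i) = c *\<^sub>R (\<Sum>i<n. (a i / c) *\<^sub>R y i)"
      using c by (simp add: scaleR_sum_right)
    ultimately show ?thesis
      using c by (simp add: is_norm_scale[OF N])
  qed
  have lower: "\<bar>a j\<bar> \<le> 4 * N (\<Sum>i<n. a i *\<^sub>R y i)" if j: "j < n" for n a j
  proof -
    have "Max ((\<lambda>i. \<bar>a i\<bar>) ` {..<n}) \<in> (\<lambda>i. \<bar>a i\<bar>) ` {..<n}"
      using j by (intro Max_in) auto
    then obtain m where m: "m < n" "\<bar>a m\<bar> = Max ((\<lambda>i. \<bar>a i\<bar>) ` {..<n})"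
      by force
    then have m_max: "\<bar>a i\<bar> \<le> \<bar>a m\<bar>" if "i < n" for i
      using that by simp
    \<comment> \<open>Flipping the sign of a largest coefficient: the constants work since \<open>2 * (7 / 8) > 3 / 2\<close>.\<close>
    let ?z = "\<Sum>i<n. a i *\<^sub>R y i" and ?z' = "\<Sum>i<n. (a(m := - a m)) i *\<^sub>R y i"
    have "?z - ?z' = (\<Sum>i<n. if i = m then (2 * a m) *\<^sub>R y m else 0)"
    proof (subst sum_subtractf[symmetric], rule sum.cong)
      fix i
      show "a i *\<^sub>R y i - (a(m := - a m)) i *\<^sub>R y i = (if i = m then (2 * a m) *\<^sub>R y m else 0)"
        by (simp add: scaleR_2[symmetric] flip: scaleR_scaleR)
    qed simp
    also have "\<dots> = (2 * a m) *\<^sub>R y m"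
      using m(1) by (subst sum.delta) auto
    finally have "(2 * a m) *\<^sub>R y m = ?z + - ?z'"
      by simp
    then have "\<bar>2 * a m\<bar> * N (y m) \<le> N ?z + N ?z'"
      using is_norm_triangle[OF N, of ?z "- ?z'"] is_norm_scale[OF N, of "2 * a m" "y m"]
      by (simp add: is_norm_minus[OF N])
    moreover have "N ?z' \<le> 3 / 2 * \<bar>a m\<bar>"
      using m_max by (intro upper) auto
    moreover have "\<bar>2 * a m\<bar> * (7 / 8) \<le> \<bar>2 * a m\<bar> * N (y m)"
      using y[of m] by (intro mult_left_mono) auto
    \<comment> \<open>Together,
      \<open>7 / 4 * \<bar>a m\<bar> \<le> N ?z + 3 / 2 * \<bar>a m\<bar>\<close>; the gap
      \<open>1 / 4\<close> is the source of the factor \<open>4\<close>.\<close>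
    ultimately have "\<bar>a m\<bar> \<le> 4 * N ?z"
      by simp
    then show ?thesis
      using m_max[OF j] by simp
  qed
  show thesis
  proof (rule that[of y]; intro allI impI)
    fix n :: nat and a :: "nat \<Rightarrow> real" and c
    assume "0 \<le> c" "\<forall>i<n. \<bar>a i\<bar> \<le> c"
    then show "N (\<Sum>i<n. a i *\<^sub>R y i) \<le> 3 / 2 * c"
      using upper[of c n a] by simp
  next
    fix n j :: nat and a :: "nat \<Rightarrow> real"
    assume "j < n"
    then show "\<bar>a j\<bar> \<le> 4 * N (\<Sum>i<n. a i *\<^sub>R y i)"
      by (rule lower[of j n a])
  qed
qed

text \<open>The upper estimate on tails makes the series for \<open>T u\<close> Cauchy when
  \<open>u\<close> is a null sequence, and completeness gives the sum. In the limit the two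
  estimates make \<open>T\<close> and its inverse Lipschitz.\<close>

lemma contains_copy_of_c0I:
  fixes y :: "nat \<Rightarrow> 'a::banach"
  assumes upper: "\<And>n a c. 0 \<le> c \<Longrightarrow> (\<And>i. i < n \<Longrightarrow> \<bar>a i\<bar> \<le> c) \<Longrightarrow>
      norm (\<Sum>i<n. a i *\<^sub>R y i) \<le> B * c"
    and lower: "\<And>n a j. j < n \<Longrightarrow> \<bar>a j\<bar> \<le> A * norm (\<Sum>i<n. a i *\<^sub>R y i)"
  shows "contains_copy_of_c0 TYPE('a)"
proof -
  define T where "T u = (\<Sum>n. apply_bcontfun u n *\<^sub>R y n)" for u :: "nat \<Rightarrow>\<^sub>C real"
  \<comment> \<open>Take the empty sum with \<open>c = 1\<close>.\<close>
  have B: "0 \<le> B"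
    using upper[of 1 0 "\<lambda>_. 0"] by simp
  have A: "0 \<le> A"
  proof (rule ccontr)
    assume "\<not> 0 \<le> A"
    then have "A * norm (y 0) \<le> 0"
      by (simp add: mult_nonpos_nonneg)
    then show False
      using lower[of 0 1 "\<lambda>_. 1"] by simp
  qed
  have summable: "summable (\<lambda>n. apply_bcontfun u n *\<^sub>R y n)" if "u \<in> c0" for u
    unfolding summable_Cauchy
  proof (intro allI impI)
    fix e :: real
    assume e: "0 < e"
    define d where "d = e / (B + 1)"
    have d: "0 < d" "B * d < e"
      using e B by (auto simp: d_def field_simps)
    have "eventually (\<lambda>n. dist (apply_bcontfun u n) 0 < d) sequentially"
      using that d(1) by (intro tendstoD) (auto simp: c0_def)
    then obtain M where M: "\<And>n. n \<ge> M \<Longrightarrow> \<bar>apply_bcontfun u n\<bar> < d"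
      by (auto simp: eventually_sequentially)
    have "norm (\<Sum>i=m..<n. apply_bcontfun u i *\<^sub>R y i) < e" if m: "m \<ge> M" for m n
    proof -
      \<comment> \<open>Padding with zeros turns the block from \<open>m\<close> to \<open>n\<close>
        into an initial sum, the form covered by \<open>upper\<close>.\<close>
      let ?a = "\<lambda>i. if m \<le> i then apply_bcontfun u i else 0"
      have "(\<Sum>i=m..<n. apply_bcontfun u i *\<^sub>R y i) = (\<Sum>i<n. ?a i *\<^sub>R y i)"
        by (rule sum.mono_neutral_cong_left) auto
      also have "norm \<dots> \<le> B * d"
        using M m d(1) by (intro upper) (auto intro: less_imp_le)
      finally show ?thesis
        using d(2) by simp
    qed
    then show "\<exists>M. \<forall>m\<ge>M. \<forall>n. norm (\<Sum>i=m..<n. apply_bcontfun u i *\<^sub>R y i) < e"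
      by blast
  qed
  have T_lim: "(\<lambda>n. norm (\<Sum>i<n. apply_bcontfun u i *\<^sub>R y i)) \<longlonglongrightarrow> norm (T u)" if "u \<in> c0" for u
    unfolding T_def using summable[OF that] by (intro tendsto_norm summable_LIMSEQ)
  have T_upper: "norm (T u) \<le> B * norm u" if "u \<in> c0" for u
  proof (rule LIMSEQ_le_const2[OF T_lim[OF that]])
    show "\<exists>M. \<forall>n\<ge>M. norm (\<Sum>i<n. apply_bcontfun u i *\<^sub>R y i) \<le> B * norm u"
      using norm_bounded[of u] by (intro exI allI impI upper) auto
  qed
  have T_lower: "norm u \<le> A * norm (T u)" if "u \<in> c0" for u
  proof (rule norm_bound)
    fix j
    have "\<bar>apply_bcontfun u j\<bar> \<le> A * norm (T u)"
    proof (rule LIMSEQ_le_const[OF tendsto_mult_left[OF T_lim[OF that]]])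
      show "\<exists>M. \<forall>n\<ge>M. \<bar>apply_bcontfun u j\<bar> \<le> A * norm (\<Sum>i<n. apply_bcontfun u i *\<^sub>R y i)"
        by (intro exI[of _ "Suc j"] allI impI lower) auto
    qed
    then show "norm (apply_bcontfun u j) \<le> A * norm (T u)"
      by simp
  qed
  have T_add: "T (u + v) = T u + T v" if "u \<in> c0" "v \<in> c0" for u v
    using suminf_add[OF summable[OF that(1)] summable[OF that(2)]]
    by (simp add: T_def scaleR_add_left)
  have T_scale: "T (a *\<^sub>R u) = a *\<^sub>R T u" if "u \<in> c0" for a u
    using suminf_scaleR_right[OF summable[OF that], of a] by (simp add: T_def)
  have T_diff: "T (u - v) = T u - T v" if "u \<in> c0" "v \<in> c0" for u v
    using T_add[of u "(-1) *\<^sub>R v"] T_scale[of v "-1"] that subspace_c0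
    by (simp add: subspace_neg)
  have T0: "T 0 = 0"
    using T_scale[of 0 0] subspace_0[OF subspace_c0] by simp
  have c0_diff: "u - v \<in> c0" if "u \<in> c0" "v \<in> c0" for u v
    using subspace_diff[OF subspace_c0 that] .
  have inj: "inj_on T c0"
  proof (rule inj_onI)
    fix u v
    assume "u \<in> c0" "v \<in> c0" "T u = T v"
    then show "u = v"
      using T_lower[OF c0_diff, of u v] T_diff[of u v] by simp
  qed
  have "subspace (T ` c0)"
    unfolding subspace_def
  proof (intro conjI ballI allI)
    show "0 \<in> T ` c0"
      using T0 subspace_0[OF subspace_c0] by force
    show "p + q \<in> T ` c0" if "p \<in> T ` c0" "q \<in> T ` c0" for p q
      using that T_add subspace_add[OF subspace_c0] by (auto simp flip: T_add)
    show "a *\<^sub>R p \<in> T ` c0" if "p \<in> T ` c0" for a p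
      using that subspace_scale[OF subspace_c0] by (auto simp flip: T_scale)
  qed
  moreover have "homeomorphism c0 (T ` c0) T (inv_into c0 T)"
  proof (rule homeomorphismI)
    have "B-lipschitz_on c0 T"
      using B T_upper[OF c0_diff] T_diff by (auto intro!: lipschitz_onI simp: dist_norm)
    then show "continuous_on c0 T"
      by (rule lipschitz_on_continuous_on)
    have "A-lipschitz_on (T ` c0) (inv_into c0 T)"
      using A T_lower[OF c0_diff] T_diff
      by (auto intro!: lipschitz_onI simp: dist_norm inv_into_f_f[OF inj])
    then show "continuous_on (T ` c0) (inv_into c0 T)"
      by (rule lipschitz_on_continuous_on)
  qed (auto simp: inv_into_f_f[OF inj])
  ultimately show ?thesis
    unfolding contains_copy_of_c0_def linear_isomorphic_def using T_add T_scale by blast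
qed

theorem almost_square_contains_c0:
  fixes N :: "'a::banach \<Rightarrow> real"
  assumes eq: "equivalent_norm N" and asq: "almost_square N"
  shows "contains_copy_of_c0 TYPE('a)"
proof -
  obtain a b where N: "is_norm N" and a: "0 < a" and b: "0 < b"
    and ab: "\<And>x. a * norm x \<le> N x" "\<And>x. N x \<le> b * norm x"
    using eq unfolding equivalent_norm_def by blast
  obtain y :: "nat \<Rightarrow> 'a" where
    upper: "\<forall>n f c. 0 \<le> c \<longrightarrow> (\<forall>i<n. \<bar>f i\<bar> \<le> c) \<longrightarrow> N (\<Sum>i<n. f i *\<^sub>R y i) \<le> 3 / 2 * c"
    and lower: "\<forall>n f. \<forall>j<n. \<bar>f j\<bar> \<le> 4 * N (\<Sum>i<n. f i *\<^sub>R y i)"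
    by (rule almost_square_c0_sequence[OF N asq])
  show ?thesis
  proof (rule contains_copy_of_c0I)
    fix n :: nat and c and f :: "nat \<Rightarrow> real"
    assume "0 \<le> c" "\<And>i. i < n \<Longrightarrow> \<bar>f i\<bar> \<le> c"
    then have "N (\<Sum>i<n. f i *\<^sub>R y i) \<le> 3 / 2 * c"
      using upper by simp
    with ab(1)[of "\<Sum>i<n. f i *\<^sub>R y i"] have "a * norm (\<Sum>i<n. f i *\<^sub>R y i) \<le> 3 / 2 * c"
      by linarith
    then show "norm (\<Sum>i<n. f i *\<^sub>R y i) \<le> (3 / 2 / a) * c"
      using a by (simp add: field_simps)
  next
    fix n j :: nat and f :: "nat \<Rightarrow> real"
    assume "j < n"
    then have "\<bar>f j\<bar> \<le> 4 * N (\<Sum>i<n. f i *\<^sub>R y i)"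
      using lower by simp
    with ab(2)[of "\<Sum>i<n. f i *\<^sub>R y i"]
    show "\<bar>f j\<bar> \<le> (4 * b) * norm (\<Sum>i<n. f i *\<^sub>R y i)"
      by linarith
  qed
qed

text \<open>Continuity at \<open>0\<close> bounds \<open>h\<close> on a small ball, and homogeneity
  rescales to it. The form relative to \<open>V\<close> fits the two maps of a homeomorphism, which
  are controlled only on \<open>c0\<close> and on its image.\<close>

lemma continuous_linear_on_bounded:
  fixes h :: "'a::real_normed_vector \<Rightarrow> 'b::real_normed_vector"
  assumes V: "subspace V" and cont: "continuous_on V h"
    and scale: "\<And>a v. v \<in> V \<Longrightarrow> h (a *\<^sub>R v) = a *\<^sub>R h v"
  obtains B where "0 < B" "\<And>v. v \<in> V \<Longrightarrow> norm (h v) \<le> B * norm v"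
proof -
  have V0: "0 \<in> V"
    using V by (rule subspace_0)
  have h0: "h 0 = 0"
    using scale[OF V0, of 0] by simp
  obtain d where d: "0 < d" "\<And>v. v \<in> V \<Longrightarrow> norm v < d \<Longrightarrow> norm (h v) < 1"
    using cont V0 h0 unfolding continuous_on_iff by (metis dist_0_norm dist_commute zero_less_one)
  have "norm (h v) \<le> 2 / d * norm v" if v: "v \<in> V" for v
  proof (cases "v = 0")
    case False
    let ?t = "d / (2 * norm v)"
    have "norm (?t *\<^sub>R v) < d"
      using d(1) False by simp
    then have "norm (h (?t *\<^sub>R v)) < 1"
      using v V by (intro d(2)) (auto simp: subspace_scale)
    then have "?t * norm (h v) < 1"
      using d(1) by (simp add: scale[OF v])
    then show ?thesis
      using d(1) False by (simp add: field_simps)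
  qed (simp add: h0)
  then show thesis
    using d(1) by (intro that[of "2 / d"]) auto
qed

subsection \<open>Complementing and renorming\<close>

text \<open>Norm-preserving extension gives coordinate functionals with a common bound, but they
  tend to \<open>0\<close> only on \<open>Y\<close>. Subtracting asymptotically equal functionals
  that vanish on \<open>Y\<close> gives convergence everywhere without changing the values on
  \<open>Y\<close>.\<close>

lemma c0_coordinate_functionals_extend:
  fixes Y :: "'a::real_normed_vector set" and g :: "'a \<Rightarrow> nat \<Rightarrow>\<^sub>C real"
  assumes separable: "separable_space (euclidean :: 'a topology)"
    and Y: "subspace Y" and g_c0: "\<And>y. y \<in> Y \<Longrightarrow> g y \<in> c0" and cont: "continuous_on Y g"
    and add: "\<And>x y. x \<in> Y \<Longrightarrow> y \<in> Y \<Longrightarrow> g (x + y) = g x + g y"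
    and scale: "\<And>a x. x \<in> Y \<Longrightarrow> g (a *\<^sub>R x) = a *\<^sub>R g x"
  obtains \<psi> C where "\<And>n. linear (\<psi> n)" "\<And>n x. \<bar>\<psi> n x\<bar> \<le> C * norm x"
    "\<And>n y. y \<in> Y \<Longrightarrow> \<psi> n y = apply_bcontfun (g y) n" "\<And>x. (\<lambda>n. \<psi> n x) \<longlonglongrightarrow> 0"
proof -
  obtain B where B: "0 < B" "\<And>y. y \<in> Y \<Longrightarrow> norm (g y) \<le> B * norm y"
    using continuous_linear_on_bounded[OF Y cont scale] by blast
  have "\<exists>f. linear f \<and> (\<forall>x. \<bar>f x\<bar> \<le> B * norm x) \<and> (\<forall>y\<in>Y. f y = apply_bcontfun (g y) n)" for n
  proof -
    have "\<bar>apply_bcontfun (g y) n\<bar> \<le> B * norm y" if "y \<in> Y" for y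
      using norm_bounded[of "g y" n] B(2)[OF that] by simp
    then show ?thesis
      using Hahn_Banach_norm[OF Y, of "\<lambda>y. apply_bcontfun (g y) n" B] add scale B(1)
      by (metis less_imp_le plus_bcontfun.rep_eq real_scaleR_def scaleR_bcontfun.rep_eq)
  qed
  then obtain f where f: "\<And>n. linear (f n)" "\<And>n x. \<bar>f n x\<bar> \<le> B * norm x"
    "\<And>n y. y \<in> Y \<Longrightarrow> f n y = apply_bcontfun (g y) n"
    by metis
  have lim: "(\<lambda>n. f n y) \<longlonglongrightarrow> 0" if "y \<in> Y" for y
    using g_c0[OF that] by (simp add: f(3)[OF that] c0_def)
  obtain h where h: "\<And>n. linear (h n)" "\<And>n x. \<bar>h n x\<bar> \<le> B * norm x"
    "\<And>n y. y \<in> Y \<Longrightarrow> h n y = 0" "\<And>x. (\<lambda>n. f n x - h n x) \<longlonglongrightarrow> 0"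
    using vanishing_functionals_approx[OF separable, of f B Y, OF f(1,2) lim] by blast
  show thesis
  proof (rule that[of "\<lambda>n x. f n x - h n x" "2 * B"])
    show "linear (\<lambda>x. f n x - h n x)" for n
      using f(1) h(1) by (rule linear_compose_sub)
    show "\<bar>f n x - h n x\<bar> \<le> 2 * B * norm x" for n x
      using f(2)[of n x] h(2)[of n x] by linarith
  qed (use f(3) h(3,4) in auto)
qed

text \<open>Sobczyk's theorem: \<open>f \<circ> S\<close> is a bounded projection onto \<open>Y\<close>.\<close>

theorem c0_complemented:
  fixes f :: "(nat \<Rightarrow>\<^sub>C real) \<Rightarrow> 'a::real_normed_vector"
  assumes separable: "separable_space (euclidean :: 'a topology)"
    and Y: "subspace Y" and hom: "homeomorphism c0 Y f g"
    and add: "\<And>u v. u \<in> c0 \<Longrightarrow> v \<in> c0 \<Longrightarrow> f (u + v) = f u + f v"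
    and scale: "\<And>a u. u \<in> c0 \<Longrightarrow> f (a *\<^sub>R u) = a *\<^sub>R f u"
  obtains S C where "linear S" "range S \<subseteq> c0" "\<And>x. norm (S x) \<le> C * norm x"
    "\<And>u. u \<in> c0 \<Longrightarrow> S (f u) = u"
proof -
  have gf: "\<And>u. u \<in> c0 \<Longrightarrow> g (f u) = u" and fY: "\<And>u. u \<in> c0 \<Longrightarrow> f u \<in> Y"
    and fg: "\<And>y. y \<in> Y \<Longrightarrow> f (g y) = y" and gY: "\<And>y. y \<in> Y \<Longrightarrow> g y \<in> c0"
    and cont: "continuous_on Y g"
    using hom unfolding homeomorphism_def by auto
  have g_add: "g (x + y) = g x + g y" if "x \<in> Y" "y \<in> Y" for x y
    using gf[of "g x + g y"] add[of "g x" "g y"] that gY fg subspace_add[OF subspace_c0]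
    by simp
  have g_scale: "g (a *\<^sub>R x) = a *\<^sub>R g x" if "x \<in> Y" for a x
    using gf[of "a *\<^sub>R g x"] scale[of "g x" a] that gY fg subspace_scale[OF subspace_c0]
    by simp
  obtain \<psi> C where \<psi>: "\<And>n. linear (\<psi> n)" "\<And>n x. \<bar>\<psi> n x\<bar> \<le> C * norm x"
    "\<And>n y. y \<in> Y \<Longrightarrow> \<psi> n y = apply_bcontfun (g y) n" "\<And>x. (\<lambda>n. \<psi> n x) \<longlonglongrightarrow> 0"
    using c0_coordinate_functionals_extend[OF separable Y gY cont g_add g_scale] by blast
  \<comment> \<open>The uniform bound on \<open>\<psi>\<close> makes this a bounded sequence, and
    pointwise convergence to \<open>0\<close> puts it in \<open>c0\<close>.\<close>
  define S where "S x = Bcontfun (\<lambda>n. \<psi> n x)" for x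
  have S: "apply_bcontfun (S x) = (\<lambda>n. \<psi> n x)" for x
    unfolding S_def using \<psi>(2)
    by (intro Bcontfun_inverse bcontfun_normI[where b = "C * norm x"]) auto
  show thesis
  proof
    show "linear S"
      by (rule linearI; rule bcontfun_eqI) (simp_all add: S linear_add[OF \<psi>(1)] linear_scale[OF \<psi>(1)])
    show "range S \<subseteq> c0"
      using \<psi>(4) by (auto simp: c0_def S)
    show "norm (S x) \<le> C * norm x" for x
      using \<psi>(2) by (intro norm_bound) (simp add: S)
    show "S (f u) = u" if "u \<in> c0" for u
      using that by (intro bcontfun_eqI) (simp add: S \<psi>(3) fY gf)
  qed
qed

theorem contains_c0_almost_square:
  assumes separable: "separable_space (euclidean :: 'a::real_normed_vector topology)"
    and c0: "contains_copy_of_c0 TYPE('a::real_normed_vector)"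
  obtains N :: "'a::real_normed_vector \<Rightarrow> real" where "equivalent_norm N" "almost_square N"
proof -
  obtain Y :: "'a set" and f g where Y: "subspace Y" and hom: "homeomorphism c0 Y f g"
    and add: "\<And>u v. u \<in> c0 \<Longrightarrow> v \<in> c0 \<Longrightarrow> f (u + v) = f u + f v"
    and scale: "\<And>a u. u \<in> c0 \<Longrightarrow> f (a *\<^sub>R u) = a *\<^sub>R f u"
    using c0 unfolding contains_copy_of_c0_def linear_isomorphic_def by blast
  obtain S C where S: "linear S" "range S \<subseteq> c0" "\<And>x. norm (S x) \<le> C * norm x"
    and Sf: "\<And>u. u \<in> c0 \<Longrightarrow> S (f u) = u"
    using c0_complemented[OF separable Y hom add scale] by blast
  have S_c0: "S x \<in> c0" for x
    using S(2) by auto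
  have cont: "continuous_on c0 f"
    using hom by (simp add: homeomorphism_def)
  then obtain B where B: "0 < B" "\<And>u. u \<in> c0 \<Longrightarrow> norm (f u) \<le> B * norm u"
    using continuous_linear_on_bounded[OF subspace_c0 cont scale] by blast
  \<comment> \<open>\<open>N\<close> below is the norm of \<open>ker S \<oplus>\<^sub>\<infinity> c0\<close>, transported by \<open>x \<mapsto> (R x, S x)\<close>.\<close>
  define R where "R x = x - f (S x)" for x
  have R_add: "R (x + y) = R x + R y" for x y
    by (simp add: R_def linear_add[OF S(1)] add[OF S_c0 S_c0])
  have R_scale: "R (a *\<^sub>R x) = a *\<^sub>R R x" for a x
    by (simp add: R_def linear_scale[OF S(1)] scale[OF S_c0] scaleR_diff_right)
  define N where "N x = max (norm (R x)) (norm (S x))" for x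
  \<comment> \<open>This rests on the decomposition \<open>x = R x + f (S x)\<close>.\<close>
  have lower: "norm x \<le> (1 + B) * N x" for x
  proof -
    have "norm x \<le> norm (R x) + norm (f (S x))"
      using norm_triangle_ineq[of "R x" "f (S x)"] by (simp add: R_def)
    also have "\<dots> \<le> N x + B * N x"
    proof (rule add_mono)
      show "norm (R x) \<le> N x"
        by (simp add: N_def)
      have "norm (f (S x)) \<le> B * norm (S x)"
        by (rule B(2)[OF S_c0])
      also have "\<dots> \<le> B * N x"
        using B(1) by (intro mult_left_mono) (auto simp: N_def)
      finally show "norm (f (S x)) \<le> B * N x" .
    qed
    finally show ?thesis
      by (simp add: algebra_simps)
  qed
  have upper: "N x \<le> (1 + (B + 1) * \<bar>C\<bar>) * norm x" for x
  proof -
    have "C * norm x \<le> \<bar>C\<bar> * norm x"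
      by (intro mult_right_mono) auto
    with S(3)[of x] have SC: "norm (S x) \<le> \<bar>C\<bar> * norm x"
      by linarith
    have "norm (R x) \<le> norm x + norm (f (S x))"
      unfolding R_def by (rule norm_triangle_ineq4)
    also have "\<dots> \<le> norm x + B * (\<bar>C\<bar> * norm x)"
      using B(2)[OF S_c0, of x] mult_left_mono[OF SC, of B] B(1) by linarith
    finally have "N x \<le> norm x + B * (\<bar>C\<bar> * norm x) + \<bar>C\<bar> * norm x"
      using SC B(1) by (simp add: N_def add_increasing2 add_increasing)
    then show ?thesis
      by (simp add: algebra_simps)
  qed
  have N: "is_norm N"
    unfolding is_norm_def
  proof (intro conjI allI)
    show "N x = 0 \<longleftrightarrow> x = 0" for x
    proof
      assume "N x = 0"
      with lower[of x] show "x = 0"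
        by simp
    next
      assume "x = 0"
      with upper[of 0] show "N x = 0"
        by (simp add: N_def)
    qed
    show "N (a *\<^sub>R x) = \<bar>a\<bar> * N x" for a x
      by (simp add: N_def R_scale linear_scale[OF S(1)] max_mult_distrib_left)
    show "N (x + y) \<le> N x + N y" for x y
      using norm_triangle_ineq[of "R x" "R y"] norm_triangle_ineq[of "S x" "S y"]
      unfolding N_def R_add linear_add[OF S(1)] by linarith
  qed
  have "equivalent_norm N"
    unfolding equivalent_norm_def
  proof (intro conjI exI allI N)
    show "1 / (1 + B) > 0" "1 + (B + 1) * \<bar>C\<bar> > 0"
      using B(1) by (auto intro: add_pos_nonneg)
    show "1 / (1 + B) * norm x \<le> N x" for x
      using lower[of x] B(1) by (simp add: field_simps)
  qed (rule upper)
  moreover have "almost_square N"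
  proof -
    define e where "e n = Bcontfun (\<lambda>k. if k = n then 1 else 0 :: real)" for n :: nat
    have e: "apply_bcontfun (e n) = (\<lambda>k. if k = n then 1 else 0)" for n
      unfolding e_def by (intro Bcontfun_inverse bcontfun_normI[where b = 1]) auto
    have e_c0: "e n \<in> c0" for n
      unfolding c0_def
      by (auto simp: e intro!: tendsto_eventually eventually_mono[OF eventually_gt_at_top[of n]])
    have Re: "R (f (e n)) = 0" and Se: "S (f (e n)) = e n" for n
      by (simp_all add: R_def Sf[OF e_c0])
    have norm_e: "norm (e n) = 1" for n
      using norm_bounded[of "e n" n] norm_bound[of "e n" 1] by (auto simp: e)
    \<comment> \<open>Adding \<open>t *\<^sub>R f (e n)\<close> leaves \<open>R x\<close> alone and
      alters only coordinate \<open>n\<close> of \<open>S x\<close>. All other coordinates, and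
      \<open>norm (R x)\<close>, stay at most \<open>1\<close>, so the error is governed by that one
      coordinate, which tends to \<open>0\<close> as \<open>n\<close> grows.\<close>
    have near: "\<bar>N (x + t *\<^sub>R f (e n)) - 1\<bar> \<le> \<bar>apply_bcontfun (S x) n\<bar>"
      if x: "N x = 1" and t: "\<bar>t\<bar> = 1" for x t n
    proof -
      have eq: "N (x + t *\<^sub>R f (e n)) = max (norm (R x)) (norm (S x + t *\<^sub>R e n))"
        by (simp add: N_def R_add R_scale Re Se linear_add[OF S(1)] linear_scale[OF S(1)])
      have "norm (S x + t *\<^sub>R e n) \<le> 1 + \<bar>apply_bcontfun (S x) n\<bar>"
      proof (rule norm_bound)
        fix k
        have "\<bar>apply_bcontfun (S x) k\<bar> \<le> 1"
          using norm_bounded[of "S x" k] x by (simp add: N_def)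
        then show "norm (apply_bcontfun (S x + t *\<^sub>R e n) k) \<le> 1 + \<bar>apply_bcontfun (S x) n\<bar>"
          using t by (auto simp: e)
      qed
      moreover have "1 - \<bar>apply_bcontfun (S x) n\<bar> \<le> norm (S x + t *\<^sub>R e n)"
        using norm_bounded[of "S x + t *\<^sub>R e n" n] t by (simp add: e)
      moreover have "norm (R x) \<le> 1"
        using x by (simp add: N_def)
      ultimately show ?thesis
        unfolding eq by linarith
    qed
    have lim: "(\<lambda>n. N (x + t *\<^sub>R f (e n))) \<longlonglongrightarrow> 1" if "N x = 1" "\<bar>t\<bar> = 1" for x t
    proof (rule LIM_zero_cancel, rule Lim_null_comparison)
      show "eventually (\<lambda>n. norm (N (x + t *\<^sub>R f (e n)) - 1) \<le> \<bar>apply_bcontfun (S x) n\<bar>) sequentially"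
        using near[OF that] by simp
      show "(\<lambda>n. \<bar>apply_bcontfun (S x) n\<bar>) \<longlonglongrightarrow> 0"
        using S_c0[of x] by (auto simp: c0_def intro: tendsto_rabs_zero)
    qed
    have "N (f (e n)) = 1" for n
      by (simp add: N_def Re Se norm_e)
    then show ?thesis
      \<comment> \<open>The same sequence \<open>f (e n)\<close> serves every finite subset of the
        unit sphere.\<close>
      unfolding almost_square_def using lim[of _ 1] lim[of _ "-1"]
      by (intro allI impI exI[of _ "\<lambda>n. f (e n)"]) auto
  qed
  ultimately show thesis
    by (rule that)
qed

theorem theorem2p9:
  assumes nonzero: "\<exists>x :: 'a::banach. x \<noteq> 0"
    and separable: "separable_space (euclidean :: 'a topology)"
  shows "(\<exists>N :: 'a \<Rightarrow> real. equivalent_norm N \<and> almost_square N)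
           \<longleftrightarrow> contains_copy_of_c0 TYPE('a)"
  using almost_square_contains_c0 contains_c0_almost_square[OF separable] by blast

end
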